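(* Let $m\ge1$, $T\subseteq\{0,\ldots,m-1\}$, $s=|T|$, and consider the Frobenius-factorized reduction algorithm modulo $g=x^m+\sum_{t\in T}x^t\in\mathbb{F}_2[x]$ described in the context. If $U\ne0$, the algorithm has exactly $$r=\left\lceil\log_2\frac{m}{\Delta_{\min}}\right\rceil$$ sequential feedback stages; if $U=0$, it has none. Thus, for fixed $m$ and $\Delta_{\min}$, the feedback depth is independent of $s$. In a fan-in-two XOR model with free fanout and unrestricted temporary wires, the depth $D_\oplus$ of the complete reduction $A\mapsto A\bmod g$ ($\deg A<2m$) has the upper bound $$D_\oplus\le\sum_{k=0}^{r-1}\left\lceil\log_2(1+h_k)\right\rceil+\left\lceil\log_2(1+s)\right\rceil.$$
   Context: For $t\in T$ put $\Delta_t=m-t$; if $T\neq\varnothing$, $\Delta_{\min}=\min\{\Delta_t:t\in T\}$. For $d\ge 0$, $N^d$ is the truncated right shift on $\mathbb{F}_2^m$: $(N^dy)_i=y_{i+d}$ if $0\le i<m-d$ and $(N^dy)_i=0$ if $m-d\le i<m$; $N^d=0$ for $d\ge m$. Put $U=\sum_{t\in T}N^{\Delta_t}$ and $V(Y)=\sum_{t\in T}(x^tY\bmod x^m)$ for $\deg Y<m$ (polynomials of degree below $m$ are identified with vectors in $\mathbb{F}_2^m$; empty sums are zero). If $U=0$ (equivalently $T\subseteq\{0\}$) set $r=0$; otherwise $r=\lceil\log_2(m/\Delta_{\min})\rceil$, which is also the least nonnegative integer with $U^{2^r}=0$. For $k\ge0$ let $T_k=\{t\in T:2^k\Delta_t<m\}$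 and $h_k=|T_k|$. Frobenius-factorized reduction algorithm on input $A=L+x^mH$ ($\deg L,\deg H<m$): set $Y\leftarrow H$; for $k=0,\ldots,r-1$ synchronously replace $Y$ by $Y+\sum_{t\in T_k}N^{2^k\Delta_t}Y$ (all shifts read the same stage input); return $L+V(Y)$. A feedback stage is one whole synchronous vector update of $Y$, and the feedback depth is the number of sequential feedback stages. Gate depth is measured in circuits of fan-in-two XOR gates whose inputs are the $2m$ coefficients of $A$ and whose outputs are the $m$ coefficients of $A\bmod g$, with free fanout and no restriction on the number of wires; $D_\oplus$ is the depth attainable for realizing the complete reduction. *)

theory Defs
  imports
    "HOL-Library.Z2"
    "HOL-Library.Extended_Nat"
    "HOL-Computational_Algebra.Polynomial"
    Complex_Main
begin

text \<open>
  Vectors in \<open>\<bbbF>\<^sub>2\<^sup>m\<close> are polynomials over \<^typ>\<open>bit\<close> of degree below \<open>m\<close> (with \<open>m \<ge> 1\<close>),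
  the \<open>i\<close>-th coordinate being the coefficient of \<open>x\<^sup>i\<close>.
\<close>

definition modulus :: "nat \<Rightarrow> nat set \<Rightarrow> bit poly" where
  "modulus m T = monom 1 m + (\<Sum>t\<in>T. monom 1 t)"

definition Delta :: "nat \<Rightarrow> nat \<Rightarrow> nat" where
  "Delta m t = m - t"

text \<open>Meaningful only for nonempty \<open>T\<close>.\<close>
definition Delta_min :: "nat \<Rightarrow> nat set \<Rightarrow> nat" where
  "Delta_min m T = Min (Delta m ` T)"

text \<open>The power \<open>N\<^sup>d\<close> of the truncated right shift; for \<open>d \<ge> m\<close> the sum is empty.\<close>
definition shiftN :: "nat \<Rightarrow> nat \<Rightarrow> bit poly \<Rightarrow> bit poly" where
  "shiftN m d y = (\<Sum>i<m - d. monom (coeff y (i + d)) i)"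

definition U_op :: "nat \<Rightarrow> nat set \<Rightarrow> bit poly \<Rightarrow> bit poly" where
  "U_op m T y = (\<Sum>t\<in>T. shiftN m (Delta m t) y)"

definition U_is_zero :: "nat \<Rightarrow> nat set \<Rightarrow> bool" where
  "U_is_zero m T \<longleftrightarrow> (\<forall>y. degree y < m \<longrightarrow> U_op m T y = 0)"

definition V_op :: "nat \<Rightarrow> nat set \<Rightarrow> bit poly \<Rightarrow> bit poly" where
  "V_op m T Y = (\<Sum>t\<in>T. (monom 1 t * Y) mod monom 1 m)"

definition num_rounds :: "nat \<Rightarrow> nat set \<Rightarrow> nat" where
  "num_rounds m T =
     (if U_is_zero m T then 0 else nat \<lceil>log 2 (real m / real (Delta_min m T))\<rceil>)"

definition active :: "nat \<Rightarrow> nat set \<Rightarrow> nat \<Rightarrow> nat set" where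
  "active m T k = {t \<in> T. 2 ^ k * Delta m t < m}"

text \<open>
  A feedback algorithm loads a register from its input, applies its feedback stages (each one
  a synchronous update of the whole register) in list order, and computes the result from the
  input and the final register contents.
\<close>

record feedback_algorithm =
  load :: "bit poly \<Rightarrow> bit poly"
  stages :: "(bit poly \<Rightarrow> bit poly) list"
  finish :: "bit poly \<Rightarrow> bit poly \<Rightarrow> bit poly"

definition run :: "feedback_algorithm \<Rightarrow> bit poly \<Rightarrow> bit poly" where
  "run alg A = finish alg A (fold (\<lambda>f Y. f Y) (stages alg) (load alg A))"

definition feedback_depth :: "feedback_algorithm \<Rightarrow> nat" where
  "feedback_depth alg = length (stages alg)"

definition frobenius_stage :: "nat \<Rightarrow> nat set \<Rightarrow> nat \<Rightarrow> bit poly \<Rightarrow> bit poly" where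
  "frobenius_stage m T k Y = Y + (\<Sum>t\<in>active m T k. shiftN m (2 ^ k * Delta m t) Y)"

text \<open>On input \<open>A = L + x\<^sup>m H\<close>, the high part \<open>H\<close> is \<open>A div x\<^sup>m\<close> and the low part \<open>L\<close> is \<open>A mod x\<^sup>m\<close>.\<close>
definition frobenius_reduction :: "nat \<Rightarrow> nat set \<Rightarrow> feedback_algorithm" where
  "frobenius_reduction m T =
     \<lparr> load = (\<lambda>A. A div monom 1 m),
       stages = map (frobenius_stage m T) [0..<num_rounds m T],
       finish = (\<lambda>A Y. A mod monom 1 m + V_op m T Y) \<rparr>"

text \<open>
  Circuits of fan-in-two XOR gates. For a circuit with \<open>n\<close> inputs, wires \<open>0, \<dots>, n - 1\<close> carry the
  inputs and wire \<open>n + j\<close> the output of gate \<open>j\<close>; a gate is the pair of wires it reads.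
\<close>

record xor_circuit =
  gates :: "(nat \<times> nat) list"
  outputs :: "nat list"

definition wf_circuit :: "nat \<Rightarrow> xor_circuit \<Rightarrow> bool" where
  "wf_circuit n C \<longleftrightarrow>
     (\<forall>j < length (gates C). fst (gates C ! j) < n + j \<and> snd (gates C ! j) < n + j) \<and>
     (\<forall>w \<in> set (outputs C). w < n + length (gates C))"

definition wire_values :: "xor_circuit \<Rightarrow> bit list \<Rightarrow> bit list" where
  "wire_values C xs = foldl (\<lambda>vs (a, b). vs @ [vs ! a + vs ! b]) xs (gates C)"

definition circuit_eval :: "xor_circuit \<Rightarrow> bit list \<Rightarrow> bit list" where
  "circuit_eval C xs = map (\<lambda>w. wire_values C xs ! w) (outputs C)"

definition wire_depths :: "nat \<Rightarrow> xor_circuit \<Rightarrow> nat list" where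
  "wire_depths n C =
     foldl (\<lambda>ds (a, b). ds @ [Suc (max (ds ! a) (ds ! b))]) (replicate n 0) (gates C)"

text \<open>The largest number of gates on a path from an input to an output.\<close>
definition circuit_depth :: "nat \<Rightarrow> xor_circuit \<Rightarrow> nat" where
  "circuit_depth n C = Max ((\<lambda>w. wire_depths n C ! w) ` set (outputs C))"

definition realizes_reduction :: "nat \<Rightarrow> bit poly \<Rightarrow> xor_circuit \<Rightarrow> bool" where
  "realizes_reduction m g C \<longleftrightarrow>
     wf_circuit (2 * m) C \<and>
     (\<forall>A. degree A < 2 * m \<longrightarrow>
        circuit_eval C (map (coeff A) [0..<2 * m]) = map (coeff (A mod g)) [0..<m])"

text \<open>
  The least depth of a circuit for \<open>A \<mapsto> A mod g\<close>. It is infinite if there is no such circuit,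
  so a finite upper bound asserts that one exists.
\<close>
definition D_xor :: "nat \<Rightarrow> bit poly \<Rightarrow> enat" where
  "D_xor m g = (INF C \<in> {C. realizes_reduction m g C}. enat (circuit_depth (2 * m) C))"

end

theory Submission imports Defs begin

text \<open>
  Stage \<open>k\<close> is \<open>S\<^sub>k = I + U^(2^k)\<close>; in characteristic 2, \<open>S\<^sub>k S\<^sub>k = S\<^sub>k\<^sub>+\<^sub>1\<close>, because the cross terms
  of the square cancel in pairs. If \<open>Y\<^sub>k\<close> is the register before stage \<open>k\<close>, then \<open>S\<^sub>0 Y\<^sub>k = S\<^sub>k H\<close> by
  induction, and since all shifts of stage \<open>r\<close> vanish, the final register satisfies \<open>Y + U Y = H\<close>.
  As \<open>x\<^sup>t Y = x\<^sup>m (N^(m - t) Y) + (x\<^sup>t Y mod x\<^sup>m)\<close>, this gives \<open>A = g Y + (L + V Y)\<close>, so \<open>Y\<close> is the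
  quotient and \<open>L + V Y\<close> the remainder. The depth bound follows by computing every coordinate of
  every stage with a balanced tree of XOR gates.
\<close>

section \<open>Sums over bits and their cancellation\<close>

text \<open>As a simp rule it would turn \<open>+\<close> on bits into \<open>XOR\<close>, where the
  lemmas on rings and sums no longer match.\<close>

declare add_bit_eq_xor [simp del]

lemma bit_add_self: "b + b = (0 :: bit)"
  by (simp flip: mult_2)

lemma bit_poly_add_self [simp]: "p + p = (0 :: bit poly)"
  by (rule poly_eqI) (simp only: coeff_add coeff_0 bit_add_self)

lemma bit_poly_add_self_left [simp]: "p + (p + q) = (q :: bit poly)"
  by (simp flip: add.assoc)

text \<open>The terms at \<open>(s, t)\<close> and \<open>(t, s)\<close> cancel: each inserted index
  contributes a row, an equal column and one diagonal term.\<close>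

lemma sum_sum_symmetric_char_2:
  fixes f :: "'a \<Rightarrow> 'a \<Rightarrow> bit poly"
  assumes "finite A" and sym: "\<And>s t. f s t = f t s"
  shows "(\<Sum>s\<in>A. \<Sum>t\<in>A. f s t) = (\<Sum>t\<in>A. f t t)"
  using \<open>finite A\<close>
proof (induction A rule: finite_induct)
  case (insert a A)
  have "(\<Sum>t\<in>A. f t a) = (\<Sum>t\<in>A. f a t)"
    by (intro sum.cong refl sym)
  then show ?case
    using insert by (simp add: sum.distrib ac_simps)
qed simp

section \<open>Truncated shifts and Frobenius stages\<close>

lemma coeff_shiftN: "coeff (shiftN m d y) i = (if i < m - d then coeff y (i + d) else 0)"
  by (simp add: shiftN_def coeff_sum if_distrib [of "\<lambda>c. c = _"] cong: if_cong)

lemma shiftN_add: "shiftN m d (y + z) = shiftN m d y + shiftN m d z"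
  by (rule poly_eqI) (simp add: coeff_shiftN)

lemma shiftN_sum: "shiftN m d (sum f A) = (\<Sum>a\<in>A. shiftN m d (f a))"
  by (rule poly_eqI) (simp add: coeff_shiftN coeff_sum)

lemma shiftN_shiftN: "shiftN m d (shiftN m e y) = shiftN m (d + e) y"
  by (rule poly_eqI) (auto simp: coeff_shiftN ac_simps)

lemma shiftN_eq_0: "m \<le> d \<Longrightarrow> shiftN m d y = 0"
  by (simp add: shiftN_def)

text \<open>Inactive shifts have amount at least \<open>m\<close> and vanish, so every stage can be
  summed over the same index set \<open>T\<close>.\<close>

lemma frobenius_stage_eq:
  assumes "finite T"
  shows "frobenius_stage m T k Y = Y + (\<Sum>t\<in>T. shiftN m (2 ^ k * Delta m t) Y)"
  unfolding frobenius_stage_def active_def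
  by (intro arg_cong2 [of _ _ _ _ "(+)"] sum.mono_neutral_left)
     (use assms in \<open>auto simp: shiftN_eq_0 not_less\<close>)

lemma frobenius_stage_square:
  assumes "finite T"
  shows "frobenius_stage m T k (frobenius_stage m T k Y) = frobenius_stage m T (Suc k) Y"
proof -
  define f where "f s t = shiftN m (2 ^ k * Delta m s + 2 ^ k * Delta m t) Y" for s t
  \<comment> \<open>The single sum occurs twice and cancels; only the double sum remains.\<close>
  have "frobenius_stage m T k (frobenius_stage m T k Y) = Y + (\<Sum>s\<in>T. \<Sum>t\<in>T. f s t)"
    using assms
    by (simp add: frobenius_stage_eq shiftN_add shiftN_sum shiftN_shiftN sum.distrib f_def ac_simps)
  also have "(\<Sum>s\<in>T. \<Sum>t\<in>T. f s t) = (\<Sum>t\<in>T. f t t)"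
    by (rule sum_sum_symmetric_char_2 [OF assms]) (simp add: f_def add.commute)
  finally show ?thesis
    using assms by (simp add: frobenius_stage_eq f_def algebra_simps flip: mult_2)
qed

text \<open>All shifts are powers of one operator, so their amounts add in either order.\<close>

lemma frobenius_stage_commute:
  assumes "finite T"
  shows "frobenius_stage m T j (frobenius_stage m T k Y) =
         frobenius_stage m T k (frobenius_stage m T j Y)"
proof -
  have "(\<Sum>s\<in>T. \<Sum>t\<in>T. shiftN m (2 ^ j * Delta m s + 2 ^ k * Delta m t) Y) =
        (\<Sum>t\<in>T. \<Sum>s\<in>T. shiftN m (2 ^ k * Delta m t + 2 ^ j * Delta m s) Y)"
    by (subst sum.swap) (simp add: add.commute)
  then show ?thesis
    using assms
    by (simp add: frobenius_stage_eq shiftN_add shiftN_sum shiftN_shiftN sum.distrib ac_simps)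
qed

text \<open>Stopping at an arbitrary \<open>k\<close> instead of \<open>num_rounds m T\<close> makes
  induction over the stages possible.\<close>

definition register :: "nat \<Rightarrow> nat set \<Rightarrow> nat \<Rightarrow> bit poly \<Rightarrow> bit poly" where
  "register m T k A = fold (\<lambda>f Y. f Y) (map (frobenius_stage m T) [0..<k]) (A div monom 1 m)"

lemma register_0: "register m T 0 A = A div monom 1 m"
  by (simp add: register_def)

lemma register_Suc: "register m T (Suc k) A = frobenius_stage m T k (register m T k A)"
  by (simp add: register_def)

lemma run_frobenius_reduction:
  "run (frobenius_reduction m T) A =
   A mod monom 1 m + V_op m T (register m T (num_rounds m T) A)"
  by (simp add: run_def frobenius_reduction_def register_def)

text \<open>Stage 0 moves past stage \<open>k\<close> to meet the register; the induction hypothesis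
  then leaves stage \<open>k\<close> applied twice to the high part, which is stage
  \<open>Suc k\<close>.\<close>

lemma frobenius_stage_0_register:
  assumes "finite T"
  shows "frobenius_stage m T 0 (register m T k A) = frobenius_stage m T k (A div monom 1 m)"
proof (induction k)
  case 0
  show ?case by (simp add: register_0)
next
  case (Suc k)
  have "frobenius_stage m T 0 (register m T (Suc k) A) =
        frobenius_stage m T k (frobenius_stage m T 0 (register m T k A))"
    by (simp add: register_Suc frobenius_stage_commute [OF assms, of m 0])
  then show ?case
    by (simp add: Suc frobenius_stage_square [OF assms])
qed

section \<open>The number of rounds\<close>

lemma U_is_zero_iff:
  assumes "m \<ge> 1" "T \<subseteq> {0..m - 1}"
  shows "U_is_zero m T \<longleftrightarrow> T \<subseteq> {0}"
proof
  assume "T \<subseteq> {0}"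
  then show "U_is_zero m T"
    by (auto simp: U_is_zero_def U_op_def Delta_def shiftN_eq_0 intro!: sum.neutral)
next
  assume U: "U_is_zero m T"
  show "T \<subseteq> {0}"
  proof
    fix t assume t: "t \<in> T"
    show "t \<in> {0}"
    proof (rule ccontr)
      assume "t \<notin> {0}"
      then have pos: "t > 0" by simp
      have fin: "finite T" using assms(2) finite_subset by blast
      \<comment> \<open>The shift by \<open>Delta m u\<close> sends \<open>x^(m-1)\<close> to
        \<open>x^(u-1)\<close> if \<open>u > 0\<close> and to 0 if \<open>u = 0\<close>, so
        coefficient \<open>t - 1\<close> isolates the summand of \<open>t\<close>.\<close>
      have "coeff (U_op m T (monom 1 (m - 1))) (t - 1) = (\<Sum>u\<in>T. if u = t then 1 else 0)"
        unfolding U_op_def coeff_sum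
        using assms t pos by (intro sum.cong) (auto simp: coeff_shiftN Delta_def subset_iff)
      also have "\<dots> = 1" using t fin by simp
      finally have "U_op m T (monom 1 (m - 1)) \<noteq> 0" by auto
      moreover have "degree (monom (1 :: bit) (m - 1)) < m"
        using assms(1) by (simp add: degree_monom_eq)
      ultimately show False using U by (auto simp: U_is_zero_def)
    qed
  qed
qed

lemma Delta_min_bounds:
  assumes "m \<ge> 1" "T \<subseteq> {0..m - 1}" "T \<noteq> {}"
  shows "0 < Delta_min m T" "Delta_min m T \<le> m"
proof -
  have fin: "finite T" using assms(2) finite_subset by blast
  then have "Delta_min m T \<in> Delta m ` T"
    using assms(3) by (auto simp: Delta_min_def intro!: Min_in)
  then show "0 < Delta_min m T" "Delta_min m T \<le> m"
    using assms by (auto simp: Delta_def subset_iff)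
qed

text \<open>If \<open>U\<close> is zero, then \<open>T = {0}\<close> and
  \<open>Delta_min m T = m\<close>, so the logarithm is 0 as well. One formula thus covers all
  nonempty \<open>T\<close>, which gives the independence of \<open>card T\<close>.\<close>

lemma num_rounds_eq:
  assumes "m \<ge> 1" "T \<subseteq> {0..m - 1}" "T \<noteq> {}"
  shows "int (num_rounds m T) = \<lceil>log 2 (real m / real (Delta_min m T))\<rceil>"
proof (cases "U_is_zero m T")
  case True
  then have "T = {0}" using assms U_is_zero_iff by blast
  then show ?thesis using assms True by (simp add: num_rounds_def Delta_min_def Delta_def)
next
  case False
  have "0 \<le> log 2 (real m / real (Delta_min m T))"
    using Delta_min_bounds [OF assms] by (simp add: le_divide_eq)
  then show ?thesis using False by (simp add: num_rounds_def ceiling_mono [of 0, simplified])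
qed

text \<open>Truncation by \<open>nat\<close> can only enlarge the exponent, so \<open>x < 1\<close>
  is covered too.\<close>

lemma le_two_power_ceiling_log:
  fixes x :: real
  assumes "x > 0"
  shows "x \<le> 2 ^ nat \<lceil>log 2 x\<rceil>"
proof -
  have "log 2 x \<le> real (nat \<lceil>log 2 x\<rceil>)" by linarith
  then have "x \<le> 2 powr real (nat \<lceil>log 2 x\<rceil>)"
    using assms by (simp add: log_le_iff)
  then show ?thesis by (simp add: powr_realpow)
qed

text \<open>The smallest shift decides: once it reaches \<open>m\<close>, all do, and the stage
  numbered \<open>num_rounds m T\<close> is the identity.\<close>

lemma le_two_power_num_rounds:
  assumes "m \<ge> 1" "T \<subseteq> {0..m - 1}" "t \<in> T"
  shows "m \<le> 2 ^ num_rounds m T * Delta m t"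
proof -
  have ne: "T \<noteq> {}" using assms by auto
  note bounds = Delta_min_bounds [OF assms(1,2) ne]
  have "finite T" using assms(2) finite_subset by blast
  then have le: "Delta_min m T \<le> Delta m t"
    using assms(3) by (simp add: Delta_min_def)
  have "num_rounds m T = nat \<lceil>log 2 (real m / real (Delta_min m T))\<rceil>"
    by (simp flip: num_rounds_eq [OF assms(1,2) ne])
  then have "real m / real (Delta_min m T) \<le> 2 ^ num_rounds m T"
    using le_two_power_ceiling_log [of "real m / real (Delta_min m T)"] bounds by simp
  then have "real m \<le> real (2 ^ num_rounds m T * Delta_min m T)"
    using bounds by (simp add: divide_le_eq)
  then have "m \<le> 2 ^ num_rounds m T * Delta_min m T"
    by (simp only: of_nat_le_iff)
  also have "\<dots> \<le> 2 ^ num_rounds m T * Delta m t"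
    using le by simp
  finally show ?thesis .
qed

lemma frobenius_stage_num_rounds:
  assumes "m \<ge> 1" "T \<subseteq> {0..m - 1}"
  shows "frobenius_stage m T (num_rounds m T) Y = Y"
proof -
  have "active m T (num_rounds m T) = {}"
    using le_two_power_num_rounds [OF assms] by (auto simp: active_def not_less)
  then show ?thesis by (simp add: frobenius_stage_def)
qed

section \<open>Quotient and remainder modulo \<open>modulus m T\<close>\<close>

lemma coeff_mod_monom_1:
  "coeff ((p :: 'a :: field poly) mod monom 1 n) i = (if i < n then coeff p i else 0)"
proof (cases "i < n")
  case True
  have "coeff p i = coeff (monom 1 n * (p div monom 1 n)) i + coeff (p mod monom 1 n) i"
    by (simp only: mult_div_mod_eq flip: coeff_add)
  then show ?thesis using True by (simp add: coeff_monom_mult)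
next
  case False
  then show ?thesis
    using degree_mod_less [of "monom 1 n" p]
    by (auto simp: degree_monom_eq intro: coeff_eq_0)
qed

lemma coeff_monom_1_div:
  "coeff ((p :: 'a :: field poly) div monom 1 n) i = coeff p (i + n)"
proof -
  have "coeff p (i + n) =
      coeff (monom 1 n * (p div monom 1 n)) (i + n) + coeff (p mod monom 1 n) (i + n)"
    by (simp only: mult_div_mod_eq flip: coeff_add)
  then show ?thesis by (simp add: coeff_monom_mult coeff_mod_monom_1)
qed

text \<open>Positivity of \<open>m\<close> matters because the zero polynomial has degree 0.\<close>

lemma degree_less_iff_coeff:
  assumes "m > 0"
  shows "degree p < m \<longleftrightarrow> (\<forall>i\<ge>m. coeff p i = 0)"
  using assms
  by (metis coeff_eq_0 degree_0 leading_coeff_0_iff less_le_trans not_less)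

lemma run_frobenius_reduction_eq_mod:
  assumes "m \<ge> 1" "T \<subseteq> {0..m - 1}" "degree A < 2 * m"
  shows "run (frobenius_reduction m T) A = A mod modulus m T"
proof -
  have fin: "finite T" using assms(2) finite_subset by blast
  define H Y where "H = A div monom 1 m" and "Y = register m T (num_rounds m T) A"
  define R where "R = A mod monom 1 m + V_op m T Y"
  have H_eq: "H = Y + (\<Sum>t\<in>T. shiftN m (Delta m t) Y)"
    using frobenius_stage_0_register [OF fin, of m "num_rounds m T" A]
      frobenius_stage_num_rounds [OF assms(1,2)]
    by (simp add: frobenius_stage_eq [OF fin] H_def Y_def)
  then have Y_eq: "Y = H + (\<Sum>t\<in>T. shiftN m (Delta m t) Y)"
    by (simp add: add.assoc)
  \<comment> \<open>The fixed-point equation bounds the degree of \<open>Y\<close>: truncated shifts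
    end below \<open>m\<close>, and so does \<open>H\<close> because
    \<open>degree A < 2 * m\<close>.\<close>
  have Y_high: "coeff Y i = 0" if "i \<ge> m" for i
  proof -
    have "coeff Y i = coeff (H + (\<Sum>t\<in>T. shiftN m (Delta m t) Y)) i"
      using Y_eq by simp
    also have "\<dots> = 0"
      using that assms(3) by (simp add: H_def coeff_monom_1_div
          coeff_sum coeff_shiftN coeff_eq_0 less_diff_conv)
    finally show ?thesis .
  qed
  have split: "monom 1 t * Y = monom 1 m * shiftN m (Delta m t) Y + (monom 1 t * Y) mod monom 1 m"
    if "t \<in> T" for t
  proof -
    have "t < m" using that assms by (auto simp: subset_iff)
    \<comment> \<open>The quotient reads \<open>Y\<close> at \<open>i + (m - t)\<close> for every
      \<open>i\<close>, the truncated shift only for \<open>i < t\<close>; beyond that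
      \<open>Y_high\<close> gives 0.\<close>
    then have "(monom 1 t * Y) div monom 1 m = shiftN m (Delta m t) Y"
      by (intro poly_eqI)
         (auto simp: coeff_monom_1_div coeff_shiftN Delta_def coeff_monom_mult Y_high)
    then show ?thesis by (metis mult_div_mod_eq)
  qed
  have "modulus m T * Y = monom 1 m * Y + (\<Sum>t\<in>T. monom 1 t * Y)"
    by (simp add: modulus_def algebra_simps sum_distrib_left)
  also have "(\<Sum>t\<in>T. monom 1 t * Y) =
      (\<Sum>t\<in>T. monom 1 m * shiftN m (Delta m t) Y + (monom 1 t * Y) mod monom 1 m)"
    by (intro sum.cong refl split)
  also have "\<dots> = monom 1 m * (\<Sum>t\<in>T. shiftN m (Delta m t) Y) + V_op m T Y"
    by (simp add: sum.distrib sum_distrib_left V_op_def)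
  finally have "modulus m T * Y = monom 1 m * H + V_op m T Y"
    by (simp add: H_eq algebra_simps)
  then have "modulus m T * Y + R = monom 1 m * H + A mod monom 1 m"
    by (simp add: R_def algebra_simps)
  then have A_eq: "A = modulus m T * Y + R"
    by (simp add: H_def)
  have "coeff R i = 0" if "i \<ge> m" for i
    using that by (simp add: R_def V_op_def coeff_sum coeff_mod_monom_1)
  then have deg_R: "degree R < m"
    using assms(1) by (simp add: degree_less_iff_coeff)
  \<comment> \<open>All exponents in \<open>T\<close> are below \<open>m\<close>, so the leading
    term survives and \<open>R\<close> is small enough to be the remainder.\<close>
  have "coeff (modulus m T) m = 1"
    using assms by (auto simp: modulus_def coeff_sum subset_iff intro!: sum.neutral)
  then have "m \<le> degree (modulus m T)"
    by (intro le_degree) simp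
  then have "A mod modulus m T = R"
    using deg_R by (simp add: A_eq mod_poly_less)
  then show ?thesis
    by (simp add: run_frobenius_reduction R_def Y_def)
qed

section \<open>XOR depth of the coordinates\<close>

text \<open>
  The depth \<open>d\<close> is only an upper bound. There is no constant-zero wire, so the sums below are nonempty.
\<close>
inductive xor_computable :: "nat \<Rightarrow> nat \<Rightarrow> (bit poly \<Rightarrow> bit) \<Rightarrow> bool" for n where
  input: "i < n \<Longrightarrow> xor_computable n d (\<lambda>A. coeff A i)"
| gate: "xor_computable n d f \<Longrightarrow> xor_computable n d g \<Longrightarrow>
         xor_computable n (Suc d) (\<lambda>A. f A + g A)"

lemma xor_computable_mono:
  assumes "xor_computable n d f" "d \<le> e"
  shows "xor_computable n e f"
  using assms
proof (induction arbitrary: e)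
  case (input i d)
  then show ?case by (simp add: xor_computable.input)
next
  case (gate d f g)
  obtain e' where e: "e = Suc e'" "d \<le> e'"
    using gate.prems by (cases e) auto
  then show ?case using gate.IH by (auto intro: xor_computable.gate)
qed

lemma xor_computable_sum:
  assumes "finite I" "I \<noteq> {}" "card I \<le> 2 ^ e"
    and "\<And>i. i \<in> I \<Longrightarrow> xor_computable n d (f i)"
  shows "xor_computable n (d + e) (\<lambda>A. \<Sum>i\<in>I. f i A)"
  using assms
proof (induction e arbitrary: I)
  case 0
  then have "card I = 1"
    by (metis Suc_leI card_gt_0_iff le_antisym One_nat_def power_0)
  then obtain i where "I = {i}" by (auto simp: card_1_singleton_iff)
  then show ?case using 0 by simp
next
  case (Suc e)
  show ?case
  proof (cases "card I \<le> 2 ^ e")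
    \<comment> \<open>Splitting off \<open>2 ^ e\<close> indices could leave an empty rest here, so
      the depth bound is weakened instead.\<close>
    case True
    then have "xor_computable n (d + e) (\<lambda>A. \<Sum>i\<in>I. f i A)"
      using Suc by blast
    then show ?thesis by (rule xor_computable_mono) simp
  next
    case False
    then obtain J where J: "J \<subseteq> I" "card J = 2 ^ e"
      by (metis nle_le obtain_subset_with_card_n)
    define K where "K = I - J"
    have fin: "finite J" "finite K" using J Suc.prems(1) by (auto simp: K_def finite_subset)
    have K: "card K = card I - 2 ^ e"
      using J fin by (simp add: K_def card_Diff_subset)
    have ne: "J \<noteq> {}" "K \<noteq> {}" using J False K by auto
    have "xor_computable n (d + e) (\<lambda>A. \<Sum>i\<in>J. f i A)"
      using J Suc fin ne by (intro Suc.IH) auto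
    moreover have "xor_computable n (d + e) (\<lambda>A. \<Sum>i\<in>K. f i A)"
      using J K Suc fin ne by (intro Suc.IH) (auto simp: K_def)
    ultimately have "xor_computable n (Suc (d + e)) (\<lambda>A. (\<Sum>i\<in>J. f i A) + (\<Sum>i\<in>K. f i A))"
      by (rule xor_computable.gate)
    moreover have "(\<Sum>i\<in>I. f i A) = (\<Sum>i\<in>J. f i A) + (\<Sum>i\<in>K. f i A)" for A
      using J Suc.prems(1) by (simp add: K_def sum.subset_diff add.commute)
    ultimately show ?thesis by simp
  qed
qed

text \<open>\<open>None\<close> makes \<open>g\<close> one more leaf of the tree, so the index set
  is never empty. The bound \<open>h\<close> allows for summands that drop out at some
  coordinates.\<close>

lemma xor_computable_add_sum:
  assumes "finite I" "card I \<le> h" "xor_computable n d g"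
    and "\<And>i. i \<in> I \<Longrightarrow> xor_computable n d (f i)"
  shows "xor_computable n (d + nat \<lceil>log 2 (1 + real h)\<rceil>) (\<lambda>A. g A + (\<Sum>i\<in>I. f i A))"
proof -
  let ?I = "insert None (Some ` I)" and ?f = "\<lambda>z. case z of None \<Rightarrow> g | Some i \<Rightarrow> f i"
  have "real (1 + h) \<le> real (2 ^ nat \<lceil>log 2 (1 + real h)\<rceil>)"
    using le_two_power_ceiling_log [of "1 + real h"] by simp
  then have "1 + h \<le> 2 ^ nat \<lceil>log 2 (1 + real h)\<rceil>"
    by (simp only: of_nat_le_iff)
  moreover have "card ?I = 1 + card I"
    using assms(1) by (subst card_insert_disjoint) (auto simp: card_image)
  ultimately have "xor_computable n (d + nat \<lceil>log 2 (1 + real h)\<rceil>) (\<lambda>A. \<Sum>z\<in>?I. ?f z A)"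
    using assms by (intro xor_computable_sum) auto
  moreover have "(\<Sum>z\<in>?I. ?f z A) = g A + (\<Sum>i\<in>I. f i A)" for A
    using assms(1) by (simp add: sum.reindex)
  ultimately show ?thesis by simp
qed

lemma xor_computable_register:
  assumes "m \<ge> 1" "finite T" "i < m"
  shows "xor_computable (2 * m) (\<Sum>j<k. nat \<lceil>log 2 (1 + real (card (active m T j)))\<rceil>)
           (\<lambda>A. coeff (register m T k A) i)"
  using assms(3)
proof (induction k arbitrary: i)
  case 0
  then show ?case
    by (simp add: register_0 coeff_monom_1_div xor_computable.input)
next
  case (Suc k)
  \<comment> \<open>Shifts that run past the end at coordinate \<open>i\<close> are left out of the
    tree, since no wire carries zero.\<close>
  define I where "I = {t \<in> active m T k. i < m - 2 ^ k * Delta m t}"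
  have fin: "finite (active m T k)" using assms by (simp add: active_def)
  have "coeff (register m T (Suc k) A) i =
      coeff (register m T k A) i + (\<Sum>t\<in>I. coeff (register m T k A) (i + 2 ^ k * Delta m t))" for A
    using fin
    by (simp add: register_Suc frobenius_stage_def coeff_sum coeff_shiftN I_def sum.inter_filter)
  moreover have "card I \<le> card (active m T k)"
    using fin by (auto simp: I_def intro: card_mono)
  ultimately show ?case
    using fin Suc by (auto simp: I_def intro!: xor_computable_add_sum)
qed

lemma xor_computable_frobenius_reduction:
  assumes "m \<ge> 1" "T \<subseteq> {0..m - 1}" "i < m"
  shows "xor_computable (2 * m)
           ((\<Sum>k<num_rounds m T. nat \<lceil>log 2 (1 + real (card (active m T k)))\<rceil>)
             + nat \<lceil>log 2 (1 + real (card T))\<rceil>)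
           (\<lambda>A. coeff (run (frobenius_reduction m T) A) i)"
proof -
  have fin: "finite T" using assms(2) finite_subset by blast
  \<comment> \<open>\<open>x^t Y\<close> reaches coordinate \<open>i\<close> only if
    \<open>t \<le> i\<close>. The low part of \<open>A\<close> is the extra leaf, an input wire
    available at any depth bound.\<close>
  define I where "I = {t \<in> T. t \<le> i}"
  have "coeff (run (frobenius_reduction m T) A) i =
      coeff A i + (\<Sum>t\<in>I. coeff (register m T (num_rounds m T) A) (i - t))" for A
    using fin assms(3)
    by (auto simp: run_frobenius_reduction V_op_def coeff_sum coeff_mod_monom_1 coeff_monom_mult
        I_def sum.inter_filter intro!: sum.cong)
  moreover have "card I \<le> card T"
    using fin by (auto simp: I_def intro: card_mono)
  ultimately show ?thesis
    using fin assms
    by (auto simp: I_def intro!: xor_computable_add_sum xor_computable_register xor_computable.input)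
qed

section \<open>From computable coordinates to a circuit\<close>

abbreviation wf_gates :: "nat \<Rightarrow> (nat \<times> nat) list \<Rightarrow> bool" where
  "wf_gates n gs \<equiv> \<forall>j < length gs. fst (gs ! j) < n + j \<and> snd (gs ! j) < n + j"

abbreviation gate_values :: "(nat \<times> nat) list \<Rightarrow> bit list \<Rightarrow> bit list" where
  "gate_values gs xs \<equiv> foldl (\<lambda>vs (a, b). vs @ [vs ! a + vs ! b]) xs gs"

abbreviation gate_depths :: "nat \<Rightarrow> (nat \<times> nat) list \<Rightarrow> nat list" where
  "gate_depths n gs \<equiv> foldl (\<lambda>ds (a, b). ds @ [Suc (max (ds ! a) (ds ! b))]) (replicate n 0) gs"

lemma wf_gates_snoc:
  assumes "wf_gates n gs" "a < n + length gs" "b < n + length gs"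
  shows "wf_gates n (gs @ [(a, b)])"
  using assms by (auto simp: nth_append less_Suc_eq)

lemma length_gate_values [simp]: "length (gate_values gs xs) = length xs + length gs"
  by (induction gs rule: rev_induct) (auto split: prod.split)

lemma length_gate_depths [simp]: "length (gate_depths n gs) = n + length gs"
  by (induction gs rule: rev_induct) (auto split: prod.split)

text \<open>An invariant of growing gate lists: new gates only append wires, so values and depths of
  old wires persist.\<close>

definition carries :: "nat \<Rightarrow> (nat \<times> nat) list \<Rightarrow> nat \<Rightarrow> (bit poly \<Rightarrow> bit) \<Rightarrow> nat \<Rightarrow> bool" where
  "carries n gs d f w \<longleftrightarrow> w < n + length gs \<and> gate_depths n gs ! w \<le> d \<and>
     (\<forall>A. gate_values gs (map (coeff A) [0..<n]) ! w = f A)"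

lemma carries_snoc: "carries n gs d f w \<Longrightarrow> carries n (gs @ [p]) d f w"
  by (cases p) (auto simp: carries_def nth_append)

lemma carries_append: "carries n gs d f w \<Longrightarrow> carries n (gs @ hs) d f w"
  by (induction hs rule: rev_induct) (auto dest: carries_snoc simp flip: append_assoc)

lemma carries_gate:
  assumes "carries n gs d f a" "carries n gs d g b"
  shows "carries n (gs @ [(a, b)]) (Suc d) (\<lambda>A. f A + g A) (n + length gs)"
  using assms by (auto simp: carries_def nth_append)

text \<open>Starting from an arbitrary \<open>gs\<close> lets the second operand of a gate be built
  on top of the first, whose wire stays valid.\<close>

lemma xor_computable_carries:
  assumes "xor_computable n d f" "wf_gates n gs"
  shows "\<exists>hs w. wf_gates n (gs @ hs) \<and> carries n (gs @ hs) d f w"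
  using assms
proof (induction arbitrary: gs)
  case (input i d)
  have "carries n [] d (\<lambda>A. coeff A i) i"
    using input by (simp add: carries_def)
  from carries_append [OF this, of gs] have "carries n gs d (\<lambda>A. coeff A i) i"
    by simp
  then show ?case using input by (intro exI [of _ "[]"]) auto
next
  case (gate d f g)
  obtain hs a where hs: "wf_gates n (gs @ hs)" "carries n (gs @ hs) d f a"
    using gate by blast
  obtain ks b where ks: "wf_gates n ((gs @ hs) @ ks)" "carries n ((gs @ hs) @ ks) d g b"
    using gate.IH(2) [OF hs(1)] by blast
  have a: "carries n ((gs @ hs) @ ks) d f a"
    using hs(2) by (rule carries_append)
  have "wf_gates n (((gs @ hs) @ ks) @ [(a, b)])"
    using wf_gates_snoc [OF ks(1)] a ks(2) by (simp add: carries_def)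
  with carries_gate [OF a ks(2)] show ?case
    unfolding append_assoc by blast
qed

text \<open>All outputs share one gate list. Concatenation adds sizes but not depths, since depth
  belongs to single wires.\<close>

lemma xor_computable_list_carries:
  assumes "\<And>i. i < k \<Longrightarrow> xor_computable n d (f i)"
  shows "\<exists>gs ws. wf_gates n gs \<and> length ws = k \<and> (\<forall>i<k. carries n gs d (f i) (ws ! i))"
  using assms
proof (induction k)
  case 0
  show ?case by (intro exI [of _ "[]"]) simp
next
  case (Suc k)
  then obtain gs ws where gs: "wf_gates n gs" "length ws = k"
      "\<And>i. i < k \<Longrightarrow> carries n gs d (f i) (ws ! i)"
    by (metis less_Suc_eq)
  obtain hs w where hs: "wf_gates n (gs @ hs)" "carries n (gs @ hs) d (f k) w"
    using xor_computable_carries [OF Suc.prems gs(1)] by blast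
  have "carries n (gs @ hs) d (f i) ((ws @ [w]) ! i)" if "i < Suc k" for i
    using that gs hs by (cases "i = k") (auto simp: nth_append intro: carries_append)
  then show ?case
    using gs hs by (intro exI [of _ "gs @ hs"] exI [of _ "ws @ [w]"]) simp
qed

text \<open>\<open>F\<close> stands for the algorithm, which is proved to agree with
  \<open>A mod g\<close> for \<open>degree A < 2 * m\<close>.\<close>

lemma D_xor_le:
  assumes "m \<ge> 1"
    and comp: "\<And>i. i < m \<Longrightarrow> xor_computable (2 * m) d (\<lambda>A. coeff (F A) i)"
    and F: "\<And>A. degree A < 2 * m \<Longrightarrow> F A = A mod g"
  shows "D_xor m g \<le> enat d"
proof -
  obtain gs ws where gs: "wf_gates (2 * m) gs" "length ws = m"
      "\<And>i. i < m \<Longrightarrow> carries (2 * m) gs d (\<lambda>A. coeff (F A) i) (ws ! i)"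
    using xor_computable_list_carries [of m "2 * m" d "\<lambda>i A. coeff (F A) i"] comp by blast
  define C where "C = \<lparr>gates = gs, outputs = ws\<rparr>"
  have "wf_circuit (2 * m) C"
    using gs by (auto simp: wf_circuit_def C_def carries_def in_set_conv_nth)
  moreover have "circuit_eval C (map (coeff A) [0..<2 * m]) = map (coeff (A mod g)) [0..<m]"
    if "degree A < 2 * m" for A
    using gs F [OF that]
    by (intro nth_equalityI) (auto simp: circuit_eval_def wire_values_def C_def carries_def)
  ultimately have "realizes_reduction m g C"
    by (simp add: realizes_reduction_def)
  then have "D_xor m g \<le> enat (circuit_depth (2 * m) C)"
    unfolding D_xor_def by (intro INF_lower) simp
  \<comment> \<open>\<open>m \<ge> 1\<close> makes the output list nonempty, so \<open>Max\<close>
    is well defined.\<close>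
  also have "circuit_depth (2 * m) C \<le> d"
    using gs assms(1)
    by (auto simp: circuit_depth_def wire_depths_def C_def carries_def in_set_conv_nth
        intro!: Max.boundedI)
  finally show ?thesis by simp
qed

theorem corollary5p2:
  fixes m :: nat and T :: "nat set"
  assumes "m \<ge> 1" and "T \<subseteq> {0..m - 1}"
  shows "(\<not> U_is_zero m T \<longrightarrow>
            int (feedback_depth (frobenius_reduction m T))
              = \<lceil>log 2 (real m / real (Delta_min m T))\<rceil>) \<and>
         (U_is_zero m T \<longrightarrow> feedback_depth (frobenius_reduction m T) = 0) \<and>
         (\<forall>T'. T' \<subseteq> {0..m - 1} \<and> T \<noteq> {} \<and> T' \<noteq> {} \<and> Delta_min m T' = Delta_min m T \<longrightarrow>
            feedback_depth (frobenius_reduction m T') = feedback_depth (frobenius_reduction m T)) \<and>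
         D_xor m (modulus m T)
           \<le> enat ((\<Sum>k<num_rounds m T. nat \<lceil>log 2 (1 + real (card (active m T k)))\<rceil>)
                   + nat \<lceil>log 2 (1 + real (card T))\<rceil>)"
proof -
  have depth: "feedback_depth (frobenius_reduction m S) = num_rounds m S" for S
    by (simp add: feedback_depth_def frobenius_reduction_def)
  have rounds: "int (num_rounds m S) = \<lceil>log 2 (real m / real (Delta_min m S))\<rceil>"
    if "S \<subseteq> {0..m - 1}" "S \<noteq> {}" for S
    using num_rounds_eq assms(1) that by blast
  have "T \<noteq> {}" if "\<not> U_is_zero m T"
    using that U_is_zero_iff [OF assms] by auto
  moreover have "num_rounds m T' = num_rounds m T"
    if "T' \<subseteq> {0..m - 1}" "T \<noteq> {}" "T' \<noteq> {}" "Delta_min m T' = Delta_min m T" for T'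
    using rounds [of T'] rounds [of T] that assms(2) by simp
  moreover have "num_rounds m T = 0" if "U_is_zero m T"
    using that by (simp add: num_rounds_def)
  moreover note D_xor_le [OF assms(1) xor_computable_frobenius_reduction [OF assms]
      run_frobenius_reduction_eq_mod [OF assms]]
  ultimately show ?thesis
    using rounds [OF assms(2)] by (simp add: depth)
qed

end
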